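(* Let $u\in\mathbb{M}_2(\mathbb{C})$ be a unitary matrix. The following are equivalent: (1) $\mathrm{d}_{\mathrm{KK}}(\Delta,u\Delta u^* )=1$; (2) $u$ is a Hadamard unitary; (3) the quadruple $(\mathbb{M}_2(\mathbb{C}),\Delta,u\Delta u^*,\mathbb{C})$ is a commuting square.
   Context: $\Delta$ denotes the algebra of diagonal matrices in $\mathbb{M}_2(\mathbb{C})$. A Hadamard unitary in $\mathbb{M}_n(\mathbb{C})$ is a unitary $W$ with $|W_{ij}|=1/\sqrt n$ for all $i,j$ (equivalently, $\sqrt n\,W$ is a complex Hadamard matrix). Kadison--Kastler distance: for subspaces $\mathcal{Y},\mathcal{Z}$ of a normed space (here $\mathbb{M}_2(\mathbb{C})$ with the operator norm), with closed unit balls $(\mathcal{Y})_1,(\mathcal{Z})_1$ and $d(x,S)=\inf\{\|x-s\|:s\in S\}$, $$\mathrm{d}_{\mathrm{KK}}(\mathcal{Y},\mathcal{Z})=\max\Big\{\sup_{y\in(\mathcal{Y})_1}d(y,(\mathcal{Z})_1),\ \sup_{z\in(\mathcal{Z})_1}d(z,(\mathcal{Y})_1)\Big\}.$$ Commuting square: for unital $*$-subalgebras $\mathcal{P},\mathcal{Q}$ of $\mathbb{M}_2(\mathbb{C})$, with trace-preserving conditional expectations $E_{\mathcal{P}},E_{\mathcal{Q}}$ onto them and $E_0(X)=\frac12\operatorname{Tr}(X)\mathbb{I}_2$, the quadruple $(\mathbb{M}_2(\mathbb{C}),\mathcal{P},\mathcal{Q},\mathbb{C})$ is a commuting square if $E_{\mathcal{P}}\circ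 E_{\mathcal{Q}}=E_0=E_{\mathcal{Q}}\circ E_{\mathcal{P}}$. *)

theory Defs
  imports "HOL-Analysis.Analysis"
begin

text \<open>
  \<open>\<complex>^'n^'n\<close> is the algebra of complex matrices of size \<open>CARD('n)\<close>; the scalar multiple
  \<open>c X\<close> is written \<open>mat c ** X\<close>.
\<close>

definition cadjoint :: "complex ^ 'n ^ 'n \<Rightarrow> complex ^ 'n ^ 'n" where
  "cadjoint A = (\<chi> i j. cnj (A $ j $ i))"

definition unitary_mat :: "complex ^ 'n ^ 'n \<Rightarrow> bool" where
  "unitary_mat U \<longleftrightarrow> cadjoint U ** U = mat 1 \<and> U ** cadjoint U = mat 1"

definition hadamard_unitary :: "complex ^ 'n ^ 'n \<Rightarrow> bool" where
  "hadamard_unitary W \<longleftrightarrow>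
     unitary_mat W \<and> (\<forall>i j. cmod (W $ i $ j) = 1 / sqrt (real CARD('n)))"

definition diag_algebra :: "(complex ^ 'n ^ 'n) set" where
  "diag_algebra = {D. \<forall>i j. i \<noteq> j \<longrightarrow> D $ i $ j = 0}"

definition conj_by :: "complex ^ 'n ^ 'n \<Rightarrow> (complex ^ 'n ^ 'n) set \<Rightarrow> (complex ^ 'n ^ 'n) set" where
  "conj_by u P = (\<lambda>X. u ** X ** cadjoint u) ` P"


text \<open>
  The library norm on \<open>\<complex>^'n^'n\<close> is the Frobenius norm, so neither \<open>dist\<close> nor
  \<open>infdist\<close> can be used for distances in the operator norm.
\<close>

definition opnorm :: "complex ^ 'n ^ 'n \<Rightarrow> real" where
  "opnorm A = onorm ((*v) A)"

definition opball :: "(complex ^ 'n ^ 'n) set \<Rightarrow> (complex ^ 'n ^ 'n) set" where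
  "opball Y = {y \<in> Y. opnorm y \<le> 1}"

definition opdist :: "complex ^ 'n ^ 'n \<Rightarrow> (complex ^ 'n ^ 'n) set \<Rightarrow> real" where
  "opdist x S = (INF s\<in>S. opnorm (x - s))"

definition dKK :: "(complex ^ 'n ^ 'n) set \<Rightarrow> (complex ^ 'n ^ 'n) set \<Rightarrow> real" where
  "dKK Y Z = max (SUP y\<in>opball Y. opdist y (opball Z)) (SUP z\<in>opball Z. opdist z (opball Y))"


definition unital_star_subalgebra :: "(complex ^ 'n ^ 'n) set \<Rightarrow> bool" where
  "unital_star_subalgebra P \<longleftrightarrow>
     mat 1 \<in> P \<and>
     (\<forall>X\<in>P. \<forall>Y\<in>P. X + Y \<in> P \<and> X ** Y \<in> P) \<and>
     (\<forall>c. \<forall>X\<in>P. mat c ** X \<in> P) \<and>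
     (\<forall>X\<in>P. cadjoint X \<in> P)"

text \<open>
  A trace-preserving conditional expectation onto \<open>P\<close>: a positive linear \<open>P\<close>-bimodule map into
  \<open>P\<close> that restricts to the identity on \<open>P\<close> and preserves the trace. Positive matrices are those of the
  form \<open>A\<^sup>* A\<close>.
\<close>

definition trace_cond_exp ::
    "(complex ^ 'n ^ 'n) set \<Rightarrow> (complex ^ 'n ^ 'n \<Rightarrow> complex ^ 'n ^ 'n) \<Rightarrow> bool" where
  "trace_cond_exp P E \<longleftrightarrow>
     (\<forall>X Y. E (X + Y) = E X + E Y) \<and>
     (\<forall>c X. E (mat c ** X) = mat c ** E X) \<and>
     (\<forall>X. E X \<in> P) \<and>
     (\<forall>X\<in>P. E X = X) \<and>
     (\<forall>A\<in>P. \<forall>B\<in>P. \<forall>X. E (A ** X ** B) = A ** E X ** B) \<and>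
     (\<forall>A. \<exists>B. E (cadjoint A ** A) = cadjoint B ** B) \<and>
     (\<forall>X. trace (E X) = trace X)"

lemma trace_cadjoint_mult_eq_0:
  fixes D :: "complex ^ 'n ^ 'n"
  assumes "trace (cadjoint D ** D) = 0"
  shows "D = 0"
proof -
  have "trace (cadjoint D ** D) = complex_of_real (\<Sum>i\<in>UNIV. \<Sum>k\<in>UNIV. (cmod (D $ k $ i))\<^sup>2)"
    unfolding trace_def matrix_matrix_mult_def cadjoint_def
    by (simp add: complex_norm_square mult.commute del: of_real_power)
  with assms have "(\<Sum>i\<in>UNIV. \<Sum>k\<in>UNIV. (cmod (D $ k $ i))\<^sup>2) = 0"
    by (metis of_real_eq_0_iff)
  then show ?thesis
    by (simp add: sum_nonneg_eq_0_iff sum_nonneg vec_eq_iff)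
qed

text \<open>There is at most one such map, which justifies the quantifier in \<open>commuting_square\<close>.\<close>

lemma trace_cond_exp_unique:
  fixes P :: "(complex ^ 'n ^ 'n) set"
  assumes P: "unital_star_subalgebra P" and E: "trace_cond_exp P E" and F: "trace_cond_exp P F"
  shows "E = F"
proof
  fix X
  define D where "D = E X + mat (-1) ** F X"
  have neg: "mat (-1) ** Y = - Y" for Y :: "complex ^ 'n ^ 'n"
    by (simp add: matrix_matrix_mult_def mat_def vec_eq_iff if_distrib [of "\<lambda>x. x * _"] cong: if_cong)
  have D: "D = E X - F X" by (simp add: D_def neg)
  have "E X \<in> P" "F X \<in> P" using E F by (auto simp: trace_cond_exp_def)
  then have "D \<in> P" using P unfolding D_def unital_star_subalgebra_def by blast
  then have D': "cadjoint D \<in> P" "mat 1 \<in> P" using P by (auto simp: unital_star_subalgebra_def)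
  have *: "trace (cadjoint D ** G X) = trace (cadjoint D ** X)" if "trace_cond_exp P G" for G
  proof -
    have "G (cadjoint D ** X ** mat 1) = cadjoint D ** G X ** mat 1"
      using that D' unfolding trace_cond_exp_def by blast
    then show ?thesis
      using that unfolding trace_cond_exp_def by (metis matrix_mul_rid)
  qed
  have "cadjoint D ** D = cadjoint D ** E X - cadjoint D ** F X"
    unfolding D by (simp add: matrix_matrix_mult_def vec_eq_iff right_diff_distrib sum_subtractf)
  then have "trace (cadjoint D ** D) = 0"
    using *[OF E] *[OF F] by (simp add: trace_sub)
  then show "E X = F X"
    using trace_cadjoint_mult_eq_0 D by fastforce
qed

definition scalar_exp :: "complex ^ 'n ^ 'n \<Rightarrow> complex ^ 'n ^ 'n" where
  "scalar_exp X = mat (trace X / of_nat CARD('n))"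

text \<open>The quadruple \<open>(M\<^sub>n(\<complex>), P, Q, \<complex>)\<close> is a commuting square.\<close>

definition commuting_square :: "(complex ^ 'n ^ 'n) set \<Rightarrow> (complex ^ 'n ^ 'n) set \<Rightarrow> bool" where
  "commuting_square P Q \<longleftrightarrow>
     unital_star_subalgebra P \<and> unital_star_subalgebra Q \<and>
     (\<exists>E F. trace_cond_exp P E \<and> trace_cond_exp Q F \<and>
        E \<circ> F = scalar_exp \<and> F \<circ> E = scalar_exp)"

end

theory Submission
  imports Defs
begin

text \<open>
  The conditional expectation onto \<open>\<Delta>\<close> takes the diagonal part, and the one onto \<open>u\<Delta>u\<^sup>*\<close> is its
  conjugate by \<open>u\<close>. The diagonal of \<open>uDu\<^sup>*\<close> is the image of the diagonal of \<open>D\<close> under the doubly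
  stochastic matrix \<open>(\<bar>u\<^sub>i\<^sub>k\<bar>\<^sup>2)\<close>, and both composites are the normalised trace exactly when
  this matrix has constant entries \<open>1/n\<close>.

  For the distance, approximate \<open>z = uDu\<^sup>*\<close> in the unit ball by its diagonal part. In size 2 the error is
  an off-diagonal matrix with entries of modulus at most \<open>2\<bar>u\<^sub>1\<^sub>1\<bar>\<bar>u\<^sub>1\<^sub>2\<bar>\<close>, which is less than 1 unless
  \<open>u\<close> is Hadamard. If \<open>u\<close> is Hadamard, then every element of \<open>u\<Delta>u\<^sup>*\<close> has constant diagonal,
  hence lies at distance at least 1 from \<open>diag(1, -1)\<close>.
\<close>

section \<open>Adjoints and diagonal parts\<close>

lemma cadjoint_nth [simp]: "cadjoint A $ i $ j = cnj (A $ j $ i)"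
  by (simp add: cadjoint_def)

lemma cadjoint_cadjoint [simp]: "cadjoint (cadjoint A) = A"
  by (simp add: vec_eq_iff)

lemma cadjoint_mult: "cadjoint (A ** B) = cadjoint B ** cadjoint A"
  by (simp add: vec_eq_iff matrix_matrix_mult_def mult.commute)

lemma mat_mult_nth [simp]:
  fixes A :: "complex ^ 'n ^ 'n"
  shows "(mat c ** A) $ i $ j = c * A $ i $ j"
  by (simp add: matrix_matrix_mult_def mat_def if_distrib [of "\<lambda>x. x * _"] cong: if_cong)

lemma mult_mat_nth [simp]:
  fixes A :: "complex ^ 'n ^ 'n"
  shows "(A ** mat c) $ i $ j = c * A $ i $ j"
  by (simp add: matrix_matrix_mult_def mat_def if_distrib [of "\<lambda>x. _ * x"] mult.commute cong: if_cong)

lemma mat_mult_commute: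
  fixes A :: "complex ^ 'n ^ 'n"
  shows "A ** mat c = mat c ** A"
  by (simp add: vec_eq_iff)

lemma sandwich_add:
  fixes A B :: "complex ^ 'n ^ 'n"
  shows "A ** (X + Y) ** B = A ** X ** B + A ** Y ** B"
  by (simp add: matrix_matrix_mult_def vec_eq_iff ring_distribs sum.distrib)

lemma sandwich_diff:
  fixes A B :: "complex ^ 'n ^ 'n"
  shows "A ** (X - Y) ** B = A ** X ** B - A ** Y ** B"
  using sandwich_add[of A "X - Y" Y B] by simp

lemma unitary_matD:
  assumes "unitary_mat u"
  shows "cadjoint u ** u = mat 1" "u ** cadjoint u = mat 1"
    "cadjoint u ** (u ** A) = A" "u ** (cadjoint u ** A) = A"
  using assms by (simp_all add: unitary_mat_def matrix_mul_assoc)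

lemma unitary_mat_cadjoint: "unitary_mat u \<Longrightarrow> unitary_mat (cadjoint u)"
  by (simp add: unitary_mat_def)

lemma unitary_row_norm:
  fixes u :: "complex ^ 'n ^ 'n"
  assumes "unitary_mat u"
  shows "(\<Sum>k\<in>UNIV. (cmod (u $ i $ k))\<^sup>2) = 1"
proof -
  have "(u ** cadjoint u) $ i $ i = 1"
    using assms by (simp add: unitary_matD mat_def)
  then have "complex_of_real (\<Sum>k\<in>UNIV. (cmod (u $ i $ k))\<^sup>2) = 1"
    by (simp add: matrix_matrix_mult_def complex_norm_square del: of_real_power)
  then show ?thesis
    using of_real_eq_1_iff by blast
qed

section \<open>The diagonal part as a conditional expectation\<close>

definition diag_part :: "complex ^ 'n ^ 'n \<Rightarrow> complex ^ 'n ^ 'n" where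
  "diag_part X = (\<chi> i j. if i = j then X $ i $ j else 0)"

lemma diag_part_nth [simp]: "diag_part X $ i $ j = (if i = j then X $ i $ i else 0)"
  by (simp add: diag_part_def)

lemma diag_part_in_diag [simp]: "diag_part X \<in> diag_algebra"
  by (simp add: diag_algebra_def)

lemma diag_mult_nth:
  fixes A D :: "complex ^ 'n ^ 'n"
  assumes "D \<in> diag_algebra"
  shows "(D ** A) $ i $ j = D $ i $ i * A $ i $ j" "(A ** D) $ i $ j = A $ i $ j * D $ j $ j"
proof -
  have "(D ** A) $ i $ j = (\<Sum>k\<in>UNIV. if k = i then D $ i $ i * A $ i $ j else 0)"
    "(A ** D) $ i $ j = (\<Sum>k\<in>UNIV. if k = j then A $ i $ j * D $ j $ j else 0)"
    \<comment> \<open>\<open>sum.delta\<close> is withheld so that both sides stay sums and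
      \<open>sum.cong\<close> can compare them term by term.\<close>
    using assms by (auto simp: matrix_matrix_mult_def diag_algebra_def simp del: sum.delta intro!: sum.cong)
  then show "(D ** A) $ i $ j = D $ i $ i * A $ i $ j" "(A ** D) $ i $ j = A $ i $ j * D $ j $ j"
    by simp_all
qed

lemma conj_diag_nth:
  assumes "D \<in> diag_algebra"
  shows "(u ** D ** cadjoint u) $ i $ j = (\<Sum>k\<in>UNIV. u $ i $ k * D $ k $ k * cnj (u $ j $ k))"
  by (subst matrix_matrix_mult_def) (simp add: diag_mult_nth[OF assms])

lemma diag_algebra_star_subalgebra:
  "unital_star_subalgebra (diag_algebra :: (complex ^ 'n ^ 'n) set)"
proof -
  have "X ** Y \<in> diag_algebra" if "X \<in> diag_algebra" "Y \<in> diag_algebra" for X Y :: "complex ^ 'n ^ 'n"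
    using that(2) by (simp add: diag_algebra_def diag_mult_nth[OF that(1)])
  then show ?thesis
    unfolding unital_star_subalgebra_def by (auto simp: diag_algebra_def mat_def[of 1])
qed

text \<open>Positivity is the clause that needs a witness: the diagonal entries of
  \<open>cadjoint A ** A\<close> are squared column norms, so its diagonal part has a diagonal
  square root.\<close>

lemma trace_cond_exp_diag_part:
  "trace_cond_exp (diag_algebra :: (complex ^ 'n ^ 'n) set) diag_part"
proof -
  have "\<exists>B. diag_part (cadjoint A ** A) = cadjoint B ** B" for A :: "complex ^ 'n ^ 'n"
  proof -
    define s where "s i = (\<Sum>k\<in>UNIV. (cmod (A $ k $ i))\<^sup>2)" for i
    define B :: "complex ^ 'n ^ 'n" where "B = (\<chi> i j. if i = j then of_real (sqrt (s i)) else 0)"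
    have B: "B \<in> diag_algebra"
      by (simp add: B_def diag_algebra_def)
    have "s i \<ge> 0" for i
      by (simp add: s_def sum_nonneg)
    then have "(cadjoint B ** B) $ i $ j = (if i = j then of_real (s i) else 0)" for i j
      unfolding diag_mult_nth(2)[OF B] by (auto simp: B_def simp flip: of_real_mult)
    moreover have "(cadjoint A ** A) $ i $ i = of_real (s i)" for i
      by (simp add: s_def matrix_matrix_mult_def complex_norm_square mult.commute del: of_real_power)
    ultimately have "diag_part (cadjoint A ** A) = cadjoint B ** B"
      by (simp add: vec_eq_iff)
    then show ?thesis ..
  qed
  moreover have "diag_part (A ** X ** B) = A ** diag_part X ** B"
    if "A \<in> diag_algebra" "B \<in> diag_algebra" for A B X :: "complex ^ 'n ^ 'n"
    using that by (auto simp: vec_eq_iff diag_mult_nth)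
  moreover have "diag_part X = X" if "X \<in> diag_algebra" for X :: "complex ^ 'n ^ 'n"
    using that by (auto simp: vec_eq_iff diag_algebra_def)
  ultimately show ?thesis
    by (auto simp: trace_cond_exp_def vec_eq_iff trace_def)
qed

section \<open>Conjugation by a unitary\<close>

text \<open>Conjugation by a unitary is a unital *-automorphism, so it carries each closure property
  of \<open>P\<close> to the image.\<close>

lemma conj_by_star_subalgebra:
  fixes u :: "complex ^ 'n ^ 'n"
  assumes u: "unitary_mat u" and P: "unital_star_subalgebra P"
  shows "unital_star_subalgebra (conj_by u P)"
proof -
  let ?c = "\<lambda>X. u ** X ** cadjoint u"
  have "mat 1 \<in> conj_by u P"
    unfolding conj_by_def
    by (rule image_eqI[of _ _ "mat 1"]) (use u P in \<open>simp_all add: unitary_matD unital_star_subalgebra_def\<close>)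
  moreover have "?c X + ?c Y = ?c (X + Y)" for X Y
    by (simp add: sandwich_add)
  moreover have "?c X ** ?c Y = ?c (X ** Y)" for X Y
    using u by (simp add: unitary_matD flip: matrix_mul_assoc)
  moreover have "mat c ** ?c X = ?c (mat c ** X)" for c X
    by (simp add: matrix_mul_assoc mat_mult_commute)
  moreover have "cadjoint (?c X) = ?c (cadjoint X)" for X
    by (simp add: cadjoint_mult matrix_mul_assoc)
  ultimately show ?thesis
    using P unfolding unital_star_subalgebra_def conj_by_def by (auto intro!: imageI)
qed

text \<open>Transport of \<open>E\<close> along the automorphism: pull \<open>X\<close> back, apply
  \<open>E\<close>, push the result forward.\<close>

definition conj_exp ::
    "complex ^ 'n ^ 'n \<Rightarrow> (complex ^ 'n ^ 'n \<Rightarrow> complex ^ 'n ^ 'n) \<Rightarrow> complex ^ 'n ^ 'n \<Rightarrow> complex ^ 'n ^ 'n"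
  where "conj_exp u E X = u ** E (cadjoint u ** X ** u) ** cadjoint u"

lemma trace_conj:
  assumes "unitary_mat u"
  shows "trace (u ** X ** cadjoint u) = trace X"
  using assms by (subst trace_mul_sym) (simp add: unitary_matD)

lemma trace_cond_exp_conj_exp:
  fixes u :: "complex ^ 'n ^ 'n"
  assumes u: "unitary_mat u" and E: "trace_cond_exp P E"
  shows "trace_cond_exp (conj_by u P) (conj_exp u E)"
  unfolding trace_cond_exp_def
proof (intro conjI allI ballI)
  note [simp] = unitary_matD[OF u]
  note E' = E[unfolded trace_cond_exp_def]
  fix X Y c
  show "conj_exp u E (X + Y) = conj_exp u E X + conj_exp u E Y"
    using E' by (simp add: conj_exp_def sandwich_add)
  have "cadjoint u ** (mat c ** X) ** u = mat c ** (cadjoint u ** X ** u)"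
    by (simp add: matrix_mul_assoc mat_mult_commute)
  then show "conj_exp u E (mat c ** X) = mat c ** conj_exp u E X"
    using E' by (simp add: conj_exp_def) (simp add: matrix_mul_assoc mat_mult_commute)
  show "conj_exp u E X \<in> conj_by u P"
    using E' by (auto simp: conj_exp_def conj_by_def)
  show "trace (conj_exp u E X) = trace X"
    using E' trace_conj[OF u] trace_conj[OF unitary_mat_cadjoint[OF u]]
    by (simp add: conj_exp_def)
  \<comment> \<open>Pulling back a positive matrix leaves it in the form to which positivity of
    \<open>E\<close> applies.\<close>
  have "cadjoint u ** (cadjoint X ** X) ** u = cadjoint (X ** u) ** (X ** u)"
    by (simp add: cadjoint_mult matrix_mul_assoc)
  then obtain B where B: "E (cadjoint u ** (cadjoint X ** X) ** u) = cadjoint B ** B"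
    using E' by metis
  have "conj_exp u E (cadjoint X ** X) = cadjoint (B ** cadjoint u) ** (B ** cadjoint u)"
    unfolding conj_exp_def B by (simp add: cadjoint_mult matrix_mul_assoc)
  then show "\<exists>B. conj_exp u E (cadjoint X ** X) = cadjoint B ** B" ..
next
  note [simp] = unitary_matD[OF u]
  note E' = E[unfolded trace_cond_exp_def]
  fix X assume "X \<in> conj_by u P"
  then obtain D where "D \<in> P" "X = u ** D ** cadjoint u"
    by (auto simp: conj_by_def)
  then show "conj_exp u E X = X"
    using E' by (simp add: conj_exp_def flip: matrix_mul_assoc)
next
  note [simp] = unitary_matD[OF u]
  note E' = E[unfolded trace_cond_exp_def]
  fix A B X assume "A \<in> conj_by u P" "B \<in> conj_by u P"
  then obtain C D where CD: "C \<in> P" "A = u ** C ** cadjoint u" "D \<in> P" "B = u ** D ** cadjoint u"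
    by (auto simp: conj_by_def)
  \<comment> \<open>The outer unitaries cancel, which leaves elements of \<open>P\<close> on both
    sides; the bimodule property of \<open>E\<close> now applies.\<close>
  have "cadjoint u ** (A ** X ** B) ** u = C ** (cadjoint u ** X ** u) ** D"
    using CD by (simp flip: matrix_mul_assoc)
  then have "conj_exp u E (A ** X ** B) = u ** (C ** E (cadjoint u ** X ** u) ** D) ** cadjoint u"
    using E' CD by (simp add: conj_exp_def)
  then show "conj_exp u E (A ** X ** B) = A ** conj_exp u E X ** B"
    using CD by (simp add: conj_exp_def flip: matrix_mul_assoc)
qed

section \<open>Hadamard unitaries and commuting squares\<close>

lemma hadamard_unitary_cadjoint: "hadamard_unitary u \<Longrightarrow> hadamard_unitary (cadjoint u)"
  by (simp add: hadamard_unitary_def unitary_mat_cadjoint)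

text \<open>All weights \<open>(cmod (u $ i $ k))^2\<close> equal 1/n, so each diagonal entry of the
  conjugate is the average of the diagonal of \<open>D\<close>. This serves both the commuting
  square and the lower bound on the distance.\<close>

lemma diag_part_conj_hadamard:
  fixes u :: "complex ^ 'n ^ 'n"
  assumes u: "hadamard_unitary u" and D: "D \<in> diag_algebra"
  shows "diag_part (u ** D ** cadjoint u) = scalar_exp D"
proof -
  have "u $ i $ k * D $ k $ k * cnj (u $ i $ k) = D $ k $ k / of_nat CARD('n)" for i k
  proof -
    have "u $ i $ k * cnj (u $ i $ k) = of_real ((cmod (u $ i $ k))\<^sup>2)"
      by (simp add: complex_norm_square del: of_real_power)
    also have "\<dots> = 1 / of_nat CARD('n)"
      using u by (simp add: hadamard_unitary_def power_divide del: of_real_power)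
    finally have "(u $ i $ k * cnj (u $ i $ k)) * D $ k $ k = D $ k $ k / of_nat CARD('n)"
      by simp
    then show ?thesis
      by (simp add: mult_ac)
  qed
  then show ?thesis
    by (simp add: vec_eq_iff conj_diag_nth[OF D] scalar_exp_def mat_def trace_def sum_divide_distrib)
qed

text \<open>Uniqueness of trace-preserving expectations replaces the existential quantifiers by the
  two explicit maps.\<close>

lemma commuting_square_iff:
  fixes u :: "complex ^ 'n ^ 'n"
  assumes u: "unitary_mat u"
  shows "commuting_square diag_algebra (conj_by u diag_algebra) \<longleftrightarrow>
    diag_part \<circ> conj_exp u diag_part = scalar_exp \<and> conj_exp u diag_part \<circ> diag_part = scalar_exp"
  using trace_cond_exp_unique trace_cond_exp_diag_part
    trace_cond_exp_conj_exp[OF u trace_cond_exp_diag_part]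
    diag_algebra_star_subalgebra conj_by_star_subalgebra[OF u diag_algebra_star_subalgebra]
  unfolding commuting_square_def by metis

lemma trace_diag_part [simp]: "trace (diag_part X) = trace X"
  by (simp add: trace_def)

lemma hadamard_iff_commuting_square:
  fixes u :: "complex ^ 'n ^ 'n"
  assumes u: "unitary_mat u"
  shows "hadamard_unitary u \<longleftrightarrow> commuting_square diag_algebra (conj_by u diag_algebra)"
proof
  assume h: "hadamard_unitary u"
  have tr: "trace (cadjoint u ** X ** u) = trace X" for X
    using trace_conj[OF unitary_mat_cadjoint[OF u]] by simp
  have "diag_part (conj_exp u diag_part X) = scalar_exp X" for X
    by (simp add: conj_exp_def diag_part_conj_hadamard[OF h] scalar_exp_def tr)
  moreover have "conj_exp u diag_part (diag_part X) = scalar_exp X" for X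
  proof -
    \<comment> \<open>The second composite conjugates by \<open>cadjoint u\<close>, which is again
      Hadamard.\<close>
    have "diag_part (cadjoint u ** diag_part X ** u) = scalar_exp X"
      using diag_part_conj_hadamard[OF hadamard_unitary_cadjoint[OF h], of "diag_part X"]
      by (simp add: scalar_exp_def)
    then show ?thesis
      using u by (simp add: conj_exp_def scalar_exp_def mat_mult_commute)
        (simp add: unitary_matD flip: matrix_mul_assoc)
  qed
  ultimately show "commuting_square diag_algebra (conj_by u diag_algebra)"
    by (simp add: commuting_square_iff[OF u] fun_eq_iff)
next
  assume "commuting_square diag_algebra (conj_by u diag_algebra)"
  then have eq: "diag_part (conj_exp u diag_part X) = scalar_exp X" for X
    by (metis commuting_square_iff[OF u] comp_apply)
  have "cmod (u $ i $ k) = 1 / sqrt (real CARD('n))" for i k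
  proof -
    \<comment> \<open>\<open>D\<close> is the k-th diagonal matrix unit. Its conjugate is fixed by
      \<open>conj_exp u diag_part\<close> and has i-th diagonal entry
      \<open>(cmod (u $ i $ k))^2\<close>, while \<open>scalar_exp\<close> gives 1/n there.\<close>
    define D :: "complex ^ 'n ^ 'n" where "D = (\<chi> a b. if a = k \<and> b = k then 1 else 0)"
    have D: "D \<in> diag_algebra"
      by (simp add: D_def diag_algebra_def)
    then have "conj_exp u diag_part (u ** D ** cadjoint u) = u ** D ** cadjoint u"
      using trace_cond_exp_conj_exp[OF u trace_cond_exp_diag_part]
      unfolding trace_cond_exp_def conj_by_def by blast
    then have "diag_part (u ** D ** cadjoint u) = scalar_exp (u ** D ** cadjoint u)"
      using eq by metis
    then have "diag_part (u ** D ** cadjoint u) = scalar_exp D"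
      by (simp add: scalar_exp_def trace_conj[OF u])
    then have "diag_part (u ** D ** cadjoint u) $ i $ i = scalar_exp D $ i $ i"
      by simp
    moreover have "u $ i $ l * D $ l $ l * cnj (u $ i $ l) =
        (if l = k then u $ i $ k * cnj (u $ i $ k) else 0)" for l
      by (simp add: D_def)
    moreover have "trace D = 1"
      by (simp add: trace_def D_def)
    ultimately have "u $ i $ k * cnj (u $ i $ k) = 1 / of_nat CARD('n)"
      by (simp add: conj_diag_nth[OF D] scalar_exp_def mat_def)
    then have "complex_of_real ((cmod (u $ i $ k))\<^sup>2) = of_real (1 / CARD('n))"
      by (simp add: complex_norm_square del: of_real_power)
    then have "(cmod (u $ i $ k))\<^sup>2 = 1 / CARD('n)"
      using of_real_eq_iff by blast
    then have "sqrt ((cmod (u $ i $ k))\<^sup>2) = sqrt (1 / CARD('n))"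
      by simp
    then show ?thesis
      by (simp add: real_sqrt_divide)
  qed
  with u show "hadamard_unitary u"
    by (simp add: hadamard_unitary_def)
qed

section \<open>The operator norm\<close>

lemma bounded_linear_matrix_vector_mult:
  fixes A :: "complex ^ 'n ^ 'n"
  shows "bounded_linear ((*v) A)"
proof -
  have "linear ((*v) A)"
    by (rule linearI) (simp_all add: matrix_vector_mult_def vec_eq_iff
        scaleR_conv_of_real[where 'a=complex] sum_distrib_left sum.distrib distrib_left mult_ac)
  then show ?thesis
    by (rule linear_conv_bounded_linear[THEN iffD1])
qed

lemma norm_matrix_vector_mult_le: "norm (A *v x) \<le> opnorm A * norm x"
  unfolding opnorm_def by (rule onorm[OF bounded_linear_matrix_vector_mult])

lemma opnorm_nonneg: "0 \<le> opnorm A"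
  unfolding opnorm_def by (rule onorm_pos_le[OF bounded_linear_matrix_vector_mult])

lemma opnorm_le: "(\<And>x. norm (A *v x) \<le> k * norm x) \<Longrightarrow> opnorm A \<le> k"
  unfolding opnorm_def by (rule onorm_le)

text \<open>Each entry is a coordinate of the image of a standard basis vector, which has norm
  1.\<close>

lemma cmod_nth_le_opnorm:
  fixes A :: "complex ^ 'n ^ 'n"
  shows "cmod (A $ i $ j) \<le> opnorm A"
proof -
  have "(A *v axis j 1) $ i = A $ i $ j"
    by (simp add: matrix_vector_mult_def axis_def if_distrib [of "\<lambda>x. _ * x"] cong: if_cong)
  then have "cmod (A $ i $ j) \<le> norm (A *v axis j 1)"
    by (metis Finite_Cartesian_Product.norm_nth_le)
  also have "\<dots> \<le> opnorm A * norm (axis j 1 :: complex ^ 'n)"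
    by (rule norm_matrix_vector_mult_le)
  finally show ?thesis
    by simp
qed

text \<open>The squared norm expands into a triple sum; summing over the row index first leaves the
  inner products of the columns of \<open>u\<close>, which are orthonormal.\<close>

lemma norm_unitary_mult:
  fixes u :: "complex ^ 'n ^ 'n"
  assumes "unitary_mat u"
  shows "norm (u *v x) = norm x"
proof -
  have sq: "complex_of_real ((norm y)\<^sup>2) = (\<Sum>i\<in>UNIV. y $ i * cnj (y $ i))" for y :: "complex ^ 'n"
    by (simp add: norm_vec_def L2_set_def sum_nonneg complex_norm_square del: of_real_power)
  have col: "(\<Sum>i\<in>UNIV. u $ i $ k * cnj (u $ i $ l)) = (if k = l then 1 else 0)" for k l
  proof -
    have "(cadjoint u ** u) $ l $ k = (mat 1 :: complex ^ 'n ^ 'n) $ l $ k"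
      using assms by (simp add: unitary_matD)
    then show ?thesis
      by (auto simp: matrix_matrix_mult_def mat_def mult.commute)
  qed
  have "complex_of_real ((norm (u *v x))\<^sup>2) =
      (\<Sum>i\<in>UNIV. \<Sum>k\<in>UNIV. \<Sum>l\<in>UNIV. (u $ i $ k * cnj (u $ i $ l)) * (x $ k * cnj (x $ l)))"
    unfolding sq by (simp add: matrix_vector_mult_def sum_product mult_ac)
  also have "\<dots> = (\<Sum>k\<in>UNIV. \<Sum>i\<in>UNIV. \<Sum>l\<in>UNIV. (u $ i $ k * cnj (u $ i $ l)) * (x $ k * cnj (x $ l)))"
    by (rule sum.swap)
  also have "\<dots> = (\<Sum>k\<in>UNIV. \<Sum>l\<in>UNIV. \<Sum>i\<in>UNIV. (u $ i $ k * cnj (u $ i $ l)) * (x $ k * cnj (x $ l)))"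
    by (intro sum.cong refl sum.swap)
  also have "\<dots> = (\<Sum>k\<in>UNIV. \<Sum>l\<in>UNIV. (if k = l then 1 else 0) * (x $ k * cnj (x $ l)))"
    by (simp only: col flip: sum_distrib_right)
  also have "\<dots> = complex_of_real ((norm x)\<^sup>2)"
    unfolding sq by (simp add: if_distrib [of "\<lambda>x. x * _"] cong: if_cong)
  finally have "(norm (u *v x))\<^sup>2 = (norm x)\<^sup>2"
    using of_real_eq_iff by blast
  then show ?thesis
    by simp
qed

text \<open>One inequality, proved for every unitary, gives both directions: the reverse one
  conjugates back by \<open>cadjoint u\<close>.\<close>

lemma opnorm_conj:
  fixes u :: "complex ^ 'n ^ 'n"
  assumes u: "unitary_mat u"
  shows "opnorm (u ** A ** cadjoint u) = opnorm A"
proof (rule antisym)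
  have le: "opnorm (v ** B ** cadjoint v) \<le> opnorm B" if "unitary_mat v" for v B :: "complex ^ 'n ^ 'n"
  proof (rule opnorm_le)
    fix x
    have "norm ((v ** B ** cadjoint v) *v x) = norm (B *v (cadjoint v *v x))"
      using norm_unitary_mult[OF that] by (simp flip: matrix_vector_mul_assoc)
    also have "\<dots> \<le> opnorm B * norm (cadjoint v *v x)"
      by (rule norm_matrix_vector_mult_le)
    finally show "norm ((v ** B ** cadjoint v) *v x) \<le> opnorm B * norm x"
      using norm_unitary_mult[OF unitary_mat_cadjoint[OF that]] by simp
  qed
  show "opnorm (u ** A ** cadjoint u) \<le> opnorm A"
    using u by (rule le)
  show "opnorm A \<le> opnorm (u ** A ** cadjoint u)"
    using le[OF unitary_mat_cadjoint[OF u], of "u ** A ** cadjoint u"] u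
    by (simp add: unitary_matD flip: matrix_mul_assoc)
qed

lemma opnorm_diag_le:
  fixes D :: "complex ^ 'n ^ 'n"
  assumes D: "D \<in> diag_algebra" and k: "\<And>i. cmod (D $ i $ i) \<le> k"
  shows "opnorm D \<le> k"
proof (rule opnorm_le)
  fix x
  have nonneg: "0 \<le> k"
    using norm_ge_zero k order_trans by blast
  have "(D *v x) $ i = (\<Sum>j\<in>UNIV. if j = i then D $ i $ i * x $ i else 0)" for i
    using D by (auto simp: matrix_vector_mult_def diag_algebra_def simp del: sum.delta intro!: sum.cong)
  then have "cmod ((D *v x) $ i) \<le> k * cmod (x $ i)" for i
    using k by (simp add: norm_mult mult_right_mono)
  then have "norm (D *v x) \<le> L2_set (\<lambda>i. k * cmod (x $ i)) UNIV"
    unfolding norm_vec_def by (intro L2_set_mono) auto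
  then show "norm (D *v x) \<le> k * norm x"
    using nonneg by (simp add: norm_vec_def L2_set_right_distrib)
qed

text \<open>Such a matrix swaps the two coordinates and scales each by a factor of modulus at most
  \<open>k\<close>.\<close>

lemma opnorm_offdiag_le:
  fixes A :: "complex ^ 2 ^ 2"
  assumes A: "A $ 1 $ 1 = 0" "A $ 2 $ 2 = 0" and k: "cmod (A $ 1 $ 2) \<le> k" "cmod (A $ 2 $ 1) \<le> k"
  shows "opnorm A \<le> k"
proof (rule opnorm_le)
  fix x
  have nonneg: "0 \<le> k"
    using norm_ge_zero k order_trans by blast
  have "(norm (A *v x))\<^sup>2 = (cmod (A $ 1 $ 2) * cmod (x $ 2))\<^sup>2 + (cmod (A $ 2 $ 1) * cmod (x $ 1))\<^sup>2"
    by (simp add: norm_vec_def L2_set_def sum_2 matrix_vector_mult_def A norm_mult)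
  also have "\<dots> \<le> (k * cmod (x $ 2))\<^sup>2 + (k * cmod (x $ 1))\<^sup>2"
    using k by (intro add_mono power_mono mult_right_mono) auto
  also have "\<dots> = (k * norm x)\<^sup>2"
    by (simp add: norm_vec_def L2_set_def sum_2 power_mult_distrib algebra_simps)
  finally show "norm (A *v x) \<le> k * norm x"
    by (rule power2_le_imp_le) (use nonneg in simp)
qed

lemma opnorm_0 [simp]: "opnorm 0 = 0"
  using opnorm_nonneg by (intro antisym opnorm_le) simp_all

section \<open>The Kadison-Kastler distance\<close>

lemma zero_in_diag_algebra: "0 \<in> diag_algebra"
  by (simp add: diag_algebra_def)

lemma zero_in_conj_by:
  assumes "0 \<in> P"
  shows "0 \<in> conj_by u P"
proof -
  have "0 = u ** 0 ** cadjoint u"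
    by (simp add: matrix_matrix_mult_def vec_eq_iff)
  with assms show ?thesis
    unfolding conj_by_def by blast
qed

lemma zero_in_opball: "0 \<in> Y \<Longrightarrow> 0 \<in> opball Y"
  by (simp add: opball_def)

lemma opdist_le: "s \<in> S \<Longrightarrow> opdist x S \<le> opnorm (x - s)"
  unfolding opdist_def by (rule cINF_lower) (auto intro!: bdd_belowI[of _ 0] opnorm_nonneg)

text \<open>The competitor is 0. Besides the upper bound on \<open>dKK\<close>, this bounds the
  family whose supremum is taken, as \<open>cSUP_upper\<close> requires.\<close>

lemma opdist_opball_le_1:
  assumes "0 \<in> Z" "y \<in> opball Y"
  shows "opdist y (opball Z) \<le> 1"
  using opdist_le[OF zero_in_opball[OF assms(1)], of y] assms(2) by (simp add: opball_def)

text \<open>Membership of 0 makes both unit balls nonempty, without which the real suprema have no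
  least-upper-bound property.\<close>

lemma dKK_le:
  assumes "0 \<in> Y" "0 \<in> Z"
    and "\<And>y. y \<in> opball Y \<Longrightarrow> opdist y (opball Z) \<le> k"
    and "\<And>z. z \<in> opball Z \<Longrightarrow> opdist z (opball Y) \<le> k"
  shows "dKK Y Z \<le> k"
  using assms unfolding dKK_def by (auto intro!: cSUP_least dest: zero_in_opball)

lemma opdist_le_dKK:
  assumes "0 \<in> Z" "y \<in> opball Y"
  shows "opdist y (opball Z) \<le> dKK Y Z"
  unfolding dKK_def
  by (intro max.coboundedI1 cSUP_upper assms)
    (auto intro!: bdd_aboveI[of _ 1] opdist_opball_le_1[OF assms(1)])

section \<open>Distance estimates in size 2\<close>

text \<open>Both rows and the first column have norm 1; the column is read off as a row of the
  adjoint.\<close>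

lemma unitary2_cmod:
  fixes u :: "complex ^ 2 ^ 2"
  assumes u: "unitary_mat u"
  shows "(cmod (u $ 1 $ 1))\<^sup>2 + (cmod (u $ 1 $ 2))\<^sup>2 = 1"
    and "cmod (u $ 2 $ 1) = cmod (u $ 1 $ 2)" "cmod (u $ 2 $ 2) = cmod (u $ 1 $ 1)"
proof -
  have r: "(cmod (u $ 1 $ 1))\<^sup>2 + (cmod (u $ 1 $ 2))\<^sup>2 = 1"
    "(cmod (u $ 2 $ 1))\<^sup>2 + (cmod (u $ 2 $ 2))\<^sup>2 = 1"
    "(cmod (u $ 1 $ 1))\<^sup>2 + (cmod (u $ 2 $ 1))\<^sup>2 = 1"
    using unitary_row_norm[OF u, of 1] unitary_row_norm[OF u, of 2]
      unitary_row_norm[OF unitary_mat_cadjoint[OF u], of 1] by (simp_all add: sum_2)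
  show "(cmod (u $ 1 $ 1))\<^sup>2 + (cmod (u $ 1 $ 2))\<^sup>2 = 1"
    by (rule r)
  have "(cmod (u $ 2 $ 1))\<^sup>2 = (cmod (u $ 1 $ 2))\<^sup>2" "(cmod (u $ 2 $ 2))\<^sup>2 = (cmod (u $ 1 $ 1))\<^sup>2"
    using r by linarith+
  then show "cmod (u $ 2 $ 1) = cmod (u $ 1 $ 2)" "cmod (u $ 2 $ 2) = cmod (u $ 1 $ 1)"
    by simp_all
qed

text \<open>The witness is \<open>diag_part z\<close>. It stays in the unit ball because entries are
  bounded by the operator norm, and the off-diagonal remainder is controlled by its two
  entries.\<close>

lemma near_diag:
  fixes u :: "complex ^ 2 ^ 2"
  assumes u: "unitary_mat u" and z: "z \<in> opball (conj_by u diag_algebra)"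
  shows "\<exists>s\<in>opball diag_algebra. opnorm (z - s) \<le> 2 * cmod (u $ 1 $ 1) * cmod (u $ 1 $ 2)"
proof (rule bexI)
  obtain D where D: "D \<in> diag_algebra" "z = u ** D ** cadjoint u" and z1: "opnorm z \<le> 1"
    using z by (auto simp: opball_def conj_by_def)
  have d: "cmod (D $ k $ k) \<le> 1" for k
    using cmod_nth_le_opnorm[of D k k] z1 D opnorm_conj[OF u, of D] by simp
  have "opnorm (diag_part z) \<le> 1"
    using z1 by (intro opnorm_diag_le) (auto intro: order_trans[OF cmod_nth_le_opnorm])
  then show "diag_part z \<in> opball diag_algebra"
    by (simp add: opball_def)
  have off: "cmod (z $ i $ j) \<le>
      cmod (u $ i $ 1) * cmod (u $ j $ 1) + cmod (u $ i $ 2) * cmod (u $ j $ 2)" for i j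
  proof -
    have *: "cmod (u $ i $ k * D $ k $ k * cnj (u $ j $ k)) \<le> cmod (u $ i $ k) * cmod (u $ j $ k)" for k
      using d[of k] by (simp add: norm_mult mult_left_le mult_right_mono)
    show ?thesis
      unfolding D(2) conj_diag_nth[OF D(1)] sum_2
      by (rule order_trans[OF norm_triangle_ineq add_mono[OF * *]])
  qed
  show "opnorm (z - diag_part z) \<le> 2 * cmod (u $ 1 $ 1) * cmod (u $ 1 $ 2)"
  proof (rule opnorm_offdiag_le)
    show "cmod ((z - diag_part z) $ 1 $ 2) \<le> 2 * cmod (u $ 1 $ 1) * cmod (u $ 1 $ 2)"
      "cmod ((z - diag_part z) $ 2 $ 1) \<le> 2 * cmod (u $ 1 $ 1) * cmod (u $ 1 $ 2)"
      \<comment> \<open>Since moduli agree across each diagonal of \<open>u\<close>, both products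
        in \<open>off\<close> equal \<open>cmod (u $ 1 $ 1) * cmod (u $ 1 $ 2)\<close>.\<close>
      using off[of 1 2] off[of 2 1] by (simp_all add: unitary2_cmod(2,3)[OF u])
  qed simp_all
qed

lemma dKK_le_unitary2:
  fixes u :: "complex ^ 2 ^ 2"
  assumes u: "unitary_mat u"
  shows "dKK diag_algebra (conj_by u diag_algebra) \<le> 2 * cmod (u $ 1 $ 1) * cmod (u $ 1 $ 2)"
proof (rule dKK_le)
  fix y assume y: "y \<in> opball (diag_algebra :: (complex ^ 2 ^ 2) set)"
  note u' = unitary_mat_cadjoint[OF u]
  \<comment> \<open>Conjugating by \<open>cadjoint u\<close> exchanges the roles of the two
    algebras, so \<open>near_diag\<close> for \<open>cadjoint u\<close> applies; the bound is
    unchanged because \<open>u\<close> and its adjoint have the same moduli.\<close>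
  define z where "z = cadjoint u ** y ** u"
  have "opnorm z \<le> 1"
    using opnorm_conj[OF u', of y] y by (simp add: z_def opball_def)
  moreover have "z \<in> conj_by (cadjoint u) diag_algebra"
    using y by (auto simp: z_def opball_def conj_by_def)
  ultimately obtain s where s: "s \<in> opball diag_algebra"
      "opnorm (z - s) \<le> 2 * cmod (u $ 1 $ 1) * cmod (u $ 1 $ 2)"
    using near_diag[OF u', of z] unitary2_cmod[OF u] by (auto simp: opball_def)
  have "u ** s ** cadjoint u \<in> opball (conj_by u diag_algebra)"
    using s(1) by (auto simp: opball_def conj_by_def opnorm_conj[OF u])
  moreover have "y - u ** s ** cadjoint u = u ** (z - s) ** cadjoint u"
    using u by (simp add: sandwich_diff) (simp add: z_def unitary_matD flip: matrix_mul_assoc)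
  then have "opnorm (y - u ** s ** cadjoint u) = opnorm (z - s)"
    by (simp add: opnorm_conj[OF u])
  ultimately show "opdist y (opball (conj_by u diag_algebra)) \<le> 2 * cmod (u $ 1 $ 1) * cmod (u $ 1 $ 2)"
    using s(2) opdist_le[of "u ** s ** cadjoint u" _ y] by fastforce
next
  fix z assume "z \<in> opball (conj_by u diag_algebra)"
  then show "opdist z (opball diag_algebra) \<le> 2 * cmod (u $ 1 $ 1) * cmod (u $ 1 $ 2)"
    using near_diag[OF u] by (blast intro: order_trans[OF opdist_le])
qed (simp_all add: zero_in_diag_algebra zero_in_conj_by)

lemma dKK_hadamard:
  fixes u :: "complex ^ 2 ^ 2"
  assumes h: "hadamard_unitary u"
  shows "dKK diag_algebra (conj_by u diag_algebra) = 1"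
proof (rule antisym)
  show "dKK diag_algebra (conj_by u diag_algebra) \<le> 1"
    by (intro dKK_le opdist_opball_le_1) (auto intro: zero_in_diag_algebra zero_in_conj_by)
  \<comment> \<open>The diagonal of \<open>Z\<close> is (1, -1), which no constant diagonal can
    approximate within less than 1.\<close>
  define Z :: "complex ^ 2 ^ 2" where "Z = (\<chi> i j. if i = j then if i = 1 then 1 else -1 else 0)"
  have "Z \<in> diag_algebra"
    by (simp add: Z_def diag_algebra_def)
  moreover from this have "opnorm Z \<le> 1"
    by (rule opnorm_diag_le) (simp add: Z_def)
  ultimately have Z: "Z \<in> opball diag_algebra"
    by (simp add: opball_def)
  have "1 \<le> opdist Z (opball (conj_by u diag_algebra))"
    unfolding opdist_def
  proof (rule cINF_greatest)
    show "opball (conj_by u diag_algebra) \<noteq> {}"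
      using zero_in_opball[OF zero_in_conj_by[OF zero_in_diag_algebra]] by blast
    fix s assume "s \<in> opball (conj_by u diag_algebra)"
    then obtain D where D: "D \<in> diag_algebra" "s = u ** D ** cadjoint u"
      by (auto simp: opball_def conj_by_def)
    define c where "c = trace D / 2"
    have "diag_part s $ i $ i = scalar_exp D $ i $ i" for i
      using diag_part_conj_hadamard[OF h D(1)] D(2) by simp
    then have "s $ i $ i = c" for i
      by (simp add: scalar_exp_def mat_def c_def)
    then have "cmod (1 - c) \<le> opnorm (Z - s)" "cmod (- 1 - c) \<le> opnorm (Z - s)"
      using cmod_nth_le_opnorm[of "Z - s" 1 1] cmod_nth_le_opnorm[of "Z - s" 2 2]
      by (simp_all add: Z_def)
    \<comment> \<open>The points 1 and -1 are 2 apart, so \<open>c\<close> is at distance at least 1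
      from one of them.\<close>
    moreover have "2 \<le> cmod (1 - c) + cmod (- 1 - c)"
      using norm_triangle_ineq4[of "1 - c" "- 1 - c"] by simp
    ultimately show "1 \<le> opnorm (Z - s)"
      by linarith
  qed
  also have "\<dots> \<le> dKK diag_algebra (conj_by u diag_algebra)"
    by (intro opdist_le_dKK Z zero_in_conj_by zero_in_diag_algebra)
  finally show "1 \<le> dKK diag_algebra (conj_by u diag_algebra)" .
qed

lemma hadamard_if_dKK_eq_1:
  fixes u :: "complex ^ 2 ^ 2"
  assumes u: "unitary_mat u" and dKK: "dKK diag_algebra (conj_by u diag_algebra) = 1"
  shows "hadamard_unitary u"
proof -
  define a b where "a = cmod (u $ 1 $ 1)" and "b = cmod (u $ 1 $ 2)"
  have sq: "a\<^sup>2 + b\<^sup>2 = 1"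
    using unitary2_cmod(1)[OF u] by (simp add: a_def b_def)
  have "1 \<le> 2 * a * b"
    using dKK_le_unitary2[OF u] dKK by (simp add: a_def b_def)
  \<comment> \<open>Equality case of the arithmetic-geometric mean inequality:
    \<open>2 * a * b\<close> is at least 1, which is the sum of the squares.\<close>
  then have "(a - b)\<^sup>2 \<le> 0"
    using sq by (simp add: power2_diff)
  then have "a = b"
    by simp
  then have "a\<^sup>2 = 1 / 2"
    using sq by simp
  then have "sqrt (a\<^sup>2) = sqrt (1 / 2)"
    by (rule arg_cong)
  then have "a = 1 / sqrt 2"
    by (simp add: real_sqrt_divide a_def)
  then show ?thesis
    using u \<open>a = b\<close> unitary2_cmod[OF u]
    by (simp add: hadamard_unitary_def forall_2 a_def b_def)
qed

theorem theorem3p11: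
  fixes u :: "complex ^ 2 ^ 2"
  assumes "unitary_mat u"
  shows "(dKK diag_algebra (conj_by u diag_algebra) = 1 \<longleftrightarrow> hadamard_unitary u) \<and>
         (hadamard_unitary u \<longleftrightarrow> commuting_square diag_algebra (conj_by u diag_algebra))"
  using dKK_hadamard hadamard_if_dKK_eq_1[OF assms] hadamard_iff_commuting_square[OF assms] by blast

end
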